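(* Let $\gamma$ be a real number with $|\gamma|<1$, let $\omega=\sqrt{1-\gamma^2}$, and define the complex $2\times 2$ matrices $$\sigma_1^\gamma=\tfrac12\begin{pmatrix}-i\gamma & 1\\ 1 & i\gamma\end{pmatrix},\quad \sigma_2^\gamma=\tfrac12\begin{pmatrix}0 & -i\\ i & 0\end{pmatrix},\quad \sigma_3^\gamma=\tfrac12\begin{pmatrix}1 & i\gamma\\ i\gamma & -1\end{pmatrix}.$$ Then, with respect to the matrix commutator $[A,B]=AB-BA$: (1) $(J,P_1,P_2)=\left(\frac{i}{\omega}\sigma_1^\gamma,\ i\sigma_2^\gamma,\ -\frac{i}{\omega}\sigma_3^\gamma\right)$ satisfies the elliptic Cayley-Klein relations; (2) $(J,P_1,P_2)=\left(\frac{i}{\omega}\sigma_1^\gamma,\ \sigma_2^\gamma,\ -\frac{1}{\omega}\sigma_3^\gamma\right)$ satisfies the hyperbolic Cayley-Klein relations; (3) $(J,P_1,P_2)=\left(-\frac{1}{\omega}\sigma_1^\gamma,\ i\sigma_2^\gamma,\ \frac{1}{\omega}\sigma_3^\gamma\right)$ satisfies the co-hyperbolic Cayley-Klein relations; (4) $(J,P_1,P_2)=\left(\sigma_2^\gamma,\ -\frac{1}{\omega}\sigma_1^\gamma,\ \frac{i}{\omega}\sigma_3^\gamma\right)$ satisfies the doubly hyperbolic Cayley-Klein relations.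
   Context: The normalized 2-D Cayley-Klein relations with non-vanishing curvatures for a triple $(J,P_1,P_2)$ are: - elliptic: $[J,P_1]=P_2$, $[J,P_2]=-P_1$, $[P_1,P_2]=J$; - hyperbolic (Lobachevski): $[J,P_1]=P_2$, $[J,P_2]=-P_1$, $[P_1,P_2]=-J$; - co-hyperbolic (anti-de Sitter): $[J,P_1]=P_2$, $[J,P_2]=P_1$, $[P_1,P_2]=J$; - doubly hyperbolic (de Sitter): $[J,P_1]=P_2$, $[J,P_2]=P_1$, $[P_1,P_2]=-J$. *)

theory Defs
  imports "HOL-Analysis.Analysis"
begin

definition elliptic_CK :: "('a::ab_group_add \<Rightarrow> 'a \<Rightarrow> 'a) \<Rightarrow> 'a \<times> 'a \<times> 'a \<Rightarrow> bool" where
  "elliptic_CK br = (\<lambda>(J, P1, P2). br J P1 = P2 \<and> br J P2 = - P1 \<and> br P1 P2 = J)"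

definition hyperbolic_CK :: "('a::ab_group_add \<Rightarrow> 'a \<Rightarrow> 'a) \<Rightarrow> 'a \<times> 'a \<times> 'a \<Rightarrow> bool" where
  "hyperbolic_CK br = (\<lambda>(J, P1, P2). br J P1 = P2 \<and> br J P2 = - P1 \<and> br P1 P2 = - J)"

definition co_hyperbolic_CK :: "('a::ab_group_add \<Rightarrow> 'a \<Rightarrow> 'a) \<Rightarrow> 'a \<times> 'a \<times> 'a \<Rightarrow> bool" where
  "co_hyperbolic_CK br = (\<lambda>(J, P1, P2). br J P1 = P2 \<and> br J P2 = P1 \<and> br P1 P2 = J)"

definition doubly_hyperbolic_CK :: "('a::ab_group_add \<Rightarrow> 'a \<Rightarrow> 'a) \<Rightarrow> 'a \<times> 'a \<times> 'a \<Rightarrow> bool" where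
  "doubly_hyperbolic_CK br = (\<lambda>(J, P1, P2). br J P1 = P2 \<and> br J P2 = P1 \<and> br P1 P2 = - J)"

definition mat_commutator :: "'a::ring_1 ^ 'n::finite ^ 'n \<Rightarrow> 'a ^ 'n ^ 'n \<Rightarrow> 'a ^ 'n ^ 'n" where
  "mat_commutator A B = A ** B - B ** A"

text \<open>The library's \<open>*\<^sub>R\<close> allows only real scalars, and on a matrix
  \<open>*s\<close> would require the scalar to be a row vector.\<close>

definition mat_smult :: "'a::times \<Rightarrow> 'a ^ 'n ^ 'm \<Rightarrow> 'a ^ 'n ^ 'm"  (infixr \<open>*\<^sub>M\<close> 75) where
  "c *\<^sub>M A = (\<chi> i j. c * A $ i $ j)"

definition sigma1 :: "real \<Rightarrow> complex ^ 2 ^ 2" where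
  "sigma1 \<gamma> = (1 / 2) *\<^sub>M vector [vector [- \<i> * of_real \<gamma>, 1], vector [1, \<i> * of_real \<gamma>]]"

definition sigma2 :: "real \<Rightarrow> complex ^ 2 ^ 2" where
  "sigma2 \<gamma> = (1 / 2) *\<^sub>M vector [vector [0, - \<i>], vector [\<i>, 0]]"

definition sigma3 :: "real \<Rightarrow> complex ^ 2 ^ 2" where
  "sigma3 \<gamma> = (1 / 2) *\<^sub>M vector [vector [1, \<i> * of_real \<gamma>], vector [\<i> * of_real \<gamma>, - 1]]"

end

theory Submission
  imports Defs
begin

text \<open>The matrices are deformed Pauli matrices: writing s1, s2, s3 for them, [s1,s2] = i s3
  and [s2,s3] = i s1 as usual, while [s3,s1] = i (1 - \<gamma>^2) s2 = i \<omega>^2 s2. Hence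
  s1/\<omega>, s2, s3/\<omega> obey the undeformed relations, and the four triples differ from these
  only by factors i and signs, which select the signs of the Cayley-Klein relations. Bilinearity and
  antisymmetry of the commutator reduce every required bracket to the three computed in
  \<open>mat_commutator_sigma12\<close>, \<open>mat_commutator_sigma23\<close> and
  \<open>mat_commutator_sigma13\<close>.\<close>

text \<open>The scalar must move past the entries of \<open>B\<close> in the second product, hence
  the commutative ring.\<close>

lemma mat_commutator_smult_left:
  fixes a :: "'a::comm_ring_1"
  shows "mat_commutator (a *\<^sub>M A) B = a *\<^sub>M mat_commutator A B"
  unfolding mat_commutator_def mat_smult_def matrix_matrix_mult_def vec_eq_iff
  by (simp add: sum_distrib_left right_diff_distrib mult.assoc mult.left_commute)

lemma mat_commutator_swap: "mat_commutator B A = - mat_commutator A B"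
  by (simp add: mat_commutator_def)

lemma mat_smult_uminus_right:
  fixes a :: "'a::ring"
  shows "a *\<^sub>M (- A) = - (a *\<^sub>M A)"
  by (simp add: mat_smult_def vec_eq_iff)

lemma mat_commutator_smult_right:
  fixes a :: "'a::comm_ring_1"
  shows "mat_commutator A (a *\<^sub>M B) = a *\<^sub>M mat_commutator A B"
  by (metis mat_commutator_smult_left mat_commutator_swap mat_smult_uminus_right)

lemma mat_commutator_uminus_left: "mat_commutator (- A) B = - mat_commutator A B"
  unfolding mat_commutator_def matrix_matrix_mult_def vec_eq_iff
  by (simp add: sum_negf)

lemma mat_commutator_uminus_right: "mat_commutator A (- B) = - mat_commutator A B"
  by (metis mat_commutator_swap mat_commutator_uminus_left)

lemma mat_smult_mat_smult:
  fixes a b :: "'a::semigroup_mult"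
  shows "a *\<^sub>M b *\<^sub>M A = (a * b) *\<^sub>M A"
  by (simp add: mat_smult_def vec_eq_iff mult.assoc)

lemma mat_smult_uminus_left:
  fixes a :: "'a::ring"
  shows "(- a) *\<^sub>M A = - (a *\<^sub>M A)"
  by (simp add: mat_smult_def vec_eq_iff)

lemma mat_smult_one:
  fixes A :: "'a::monoid_mult ^ 'n ^ 'm"
  shows "1 *\<^sub>M A = A"
  by (simp add: mat_smult_def vec_eq_iff)

lemmas sigma_entrywise = mat_commutator_def sigma1_def sigma2_def sigma3_def
  mat_smult_def matrix_matrix_mult_def vec_eq_iff forall_2 sum_2

lemma mat_commutator_sigma12: "mat_commutator (sigma1 \<gamma>) (sigma2 \<gamma>) = \<i> *\<^sub>M sigma3 \<gamma>"
  by (simp add: sigma_entrywise algebra_simps)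

lemma mat_commutator_sigma23: "mat_commutator (sigma2 \<gamma>) (sigma3 \<gamma>) = \<i> *\<^sub>M sigma1 \<gamma>"
  by (simp add: sigma_entrywise algebra_simps)

text \<open>The diagonals of both products cancel; off the diagonal, (i \<gamma>)^2 = -\<gamma>^2
  meets 1 and produces the factor 1 - \<gamma>^2.\<close>

lemma mat_commutator_sigma13:
  "mat_commutator (sigma1 \<gamma>) (sigma3 \<gamma>) = (- (\<i> * of_real (1 - \<gamma>\<^sup>2))) *\<^sub>M sigma2 \<gamma>"
  by (simp add: sigma_entrywise algebra_simps power2_eq_square)

theorem mainTheorem1:
  fixes \<gamma> \<omega> :: real
  assumes "\<bar>\<gamma>\<bar> < 1"
    and "\<omega> = sqrt (1 - \<gamma>\<^sup>2)"
  shows "elliptic_CK mat_commutator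
           ((\<i> / of_real \<omega>) *\<^sub>M sigma1 \<gamma>, \<i> *\<^sub>M sigma2 \<gamma>, (- (\<i> / of_real \<omega>)) *\<^sub>M sigma3 \<gamma>) \<and>
         hyperbolic_CK mat_commutator
           ((\<i> / of_real \<omega>) *\<^sub>M sigma1 \<gamma>, sigma2 \<gamma>, (- (1 / of_real \<omega>)) *\<^sub>M sigma3 \<gamma>) \<and>
         co_hyperbolic_CK mat_commutator
           ((- (1 / of_real \<omega>)) *\<^sub>M sigma1 \<gamma>, \<i> *\<^sub>M sigma2 \<gamma>, (1 / of_real \<omega>) *\<^sub>M sigma3 \<gamma>) \<and>
         doubly_hyperbolic_CK mat_commutator
           (sigma2 \<gamma>, (- (1 / of_real \<omega>)) *\<^sub>M sigma1 \<gamma>, (\<i> / of_real \<omega>) *\<^sub>M sigma3 \<gamma>)"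
proof -
  from assms(1) have "\<gamma>\<^sup>2 < 1"
    by (simp add: abs_square_less_1)
  \<comment> \<open>The bound on \<gamma> makes \<omega> nonzero, so that \<omega>^2 cancels against
    the two factors 1/\<omega>.\<close>
  then have w0: "complex_of_real \<omega> \<noteq> 0" and w2: "1 - \<gamma>\<^sup>2 = \<omega>\<^sup>2"
    using assms(2) by auto
  note c13 = mat_commutator_sigma13[of \<gamma>, unfolded w2 of_real_power]
  \<comment> \<open>Only the doubly hyperbolic triple, with J = \<open>sigma2 \<gamma>\<close>,
    needs a reversed bracket. Fixing this instance keeps the swap rule from rewriting its own
    result.\<close>
  note c = mat_commutator_sigma12[of \<gamma>] mat_commutator_sigma23[of \<gamma>] c13
    mat_commutator_swap[of "sigma2 \<gamma>" "sigma1 \<gamma>"]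
  show ?thesis
    unfolding elliptic_CK_def hyperbolic_CK_def co_hyperbolic_CK_def doubly_hyperbolic_CK_def
    using w0 by (simp add: c mat_commutator_smult_left mat_commutator_smult_right
        mat_commutator_uminus_left mat_commutator_uminus_right mat_smult_mat_smult mat_smult_uminus_left
        mat_smult_uminus_right mat_smult_one power2_eq_square)
qed

end
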